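(* (a) Assume Conjecture A (stated in the context). Then for each $b\in\{3,4\}$ and every positive integer $t$ there is a positive integer $n$ with $\nu_{1,b}(n)\ge t$. (b) Assume Conjecture B (stated in the context). Then for every integer $b\ge 5$ and every positive integer $t$ there is a positive integer $n$ with $\nu_{1,b}(n)\ge t$.
   Context: For integers $t\ge 0$, $b\ge 2$, the $t$-shifted Sloane map in base $b$ is $S_{t,b}(n)=\prod_{i=0}^k (d_i+t)$, where $n=\sum_{i=0}^k d_ib^i$ is the base-$b$ expansion of $n$ ($0\le d_i\le b-1$, $d_k>0$). $f^k$ denotes the $k$-th iterate of $f$. The persistence $\nu_{1,b}(n)$ is the smallest $k\ge0$ such that $S_{1,b}^k(n)$ is a periodic point of $S_{1,b}$ (i.e. the number of iterations to reach a fixed point or cycle). For a base $q$, a digit $d$ and a positive integer $n$, $\#d(n)_q$ is the number of occurrences of $d$ in the base-$q$ expansion of $n$ and $\#(n)_q$ the number of base-$q$ digits of $n$. Given $\varepsilon>0$, $n$ is $\varepsilon$-equidistributed in base $q$ if $\left|\frac{\#d(n)_q}{\#(n)_q}-\frac1q\right|<\varepsilon$ for every $d\in\{0,\dots,q-1\}$. Conjecture A: For every integer $q>1$, every finite set $F$ of primes that does not contain all primes dividing $q$, and every positive integer $a$, if $N_0=a$ and $N_{k+1}=N_kp_k$ with $p_k\in F$ for all $k\ge0$, then for every $\varepsilon>0$ there is $n_0$ such that $N_n$ is $\varepsilon$-equidistributed in base $q$ for all $n\ge n_0$. Conjecture B: For every integer $q>1$, every finite set $F=\{p_1,\dots,p_k\}$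 of primes that does not contain all primes dividing $q$, and every positive integer $a$, for every $\varepsilon>0$ there exists $N$ such that $a\prod_{i=1}^k p_i^{\alpha_i}$ (nonnegative integers $\alpha_i$) is $\varepsilon$-equidistributed in base $q$ whenever $\alpha_i\ge N$ for some $i$. *)

theory Defs
  imports Complex_Main "HOL-Computational_Algebra.Primes"
begin

text \<open>Base-\<open>b\<close> digits, least significant first, without leading zeros; \<open>0\<close> has the empty
  expansion. The guard \<open>b < 2\<close> only ensures termination.\<close>

fun digits :: "nat \<Rightarrow> nat \<Rightarrow> nat list" where
  "digits b n = (if b < 2 \<or> n = 0 then [] else (n mod b) # digits b (n div b))"

declare digits.simps [simp del]

lemma digits_0 [simp]: "digits b 0 = []"
  by (simp add: digits.simps)

lemma digits_rec: "b \<ge> 2 \<Longrightarrow> n > 0 \<Longrightarrow> digits b n = (n mod b) # digits b (n div b)"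
  by (simp add: digits.simps)

lemma digits_induct [consumes 1, case_names zero step]:
  assumes "b \<ge> 2" and "P 0"
    and "\<And>n. n > 0 \<Longrightarrow> P (n div b) \<Longrightarrow> P n"
  shows "P (n::nat)"
proof (induction n rule: less_induct)
  case (less n)
  show ?case
  proof (cases "n = 0")
    case False
    then have "n div b < n" using assms(1) by simp
    then show ?thesis using assms(3) less False by blast
  qed (use assms in simp)
qed

lemma digits_less:
  assumes "b \<ge> 2" shows "d \<in> set (digits b n) \<Longrightarrow> d < b"
  using assms
proof (induction n rule: digits_induct)
  case (step n)
  then show ?case using assms by (auto simp: digits_rec[OF assms])
qed simp

lemma last_digits_pos:
  assumes "b \<ge> 2" shows "n > 0 \<Longrightarrow> digits b n \<noteq> [] \<and> last (digits b n) > 0"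
  using assms
proof (induction n rule: digits_induct)
  case (step n)
  have eq: "digits b n = n mod b # digits b (n div b)"
    using step.hyps assms by (rule digits_rec[rotated])
  show ?case
  proof (cases "n div b = 0")
    case True
    then have "n mod b = n" using assms by (simp add: div_eq_0_iff)
    then show ?thesis using eq True step.hyps by simp
  next
    case False
    then show ?thesis using eq step.IH by simp
  qed
qed simp

lemma digits_expansion:
  assumes "b \<ge> 2" shows "n = (\<Sum>i<length (digits b n). digits b n ! i * b ^ i)"
  using assms
proof (induction n rule: digits_induct)
  case (step n)
  let ?ds = "digits b (n div b)"
  have "(\<Sum>i<length (digits b n). digits b n ! i * b ^ i)
      = n mod b + (\<Sum>i<length ?ds. ?ds ! i * b ^ Suc i)"
    using step assms by (simp add: digits_rec sum.lessThan_Suc_shift del: sum.lessThan_Suc)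
  also have "\<dots> = n mod b + b * (\<Sum>i<length ?ds. ?ds ! i * b ^ i)"
    by (simp add: sum_distrib_left algebra_simps)
  also have "\<dots> = n" using step by simp
  finally show ?case by simp
qed simp

definition sloane :: "nat \<Rightarrow> nat \<Rightarrow> nat \<Rightarrow> nat" where
  "sloane t b n = (\<Prod>d\<leftarrow>digits b n. d + t)"

definition periodic_point :: "('a \<Rightarrow> 'a) \<Rightarrow> 'a \<Rightarrow> bool" where
  "periodic_point f x \<longleftrightarrow> (\<exists>m>0. (f ^^ m) x = x)"

text \<open>The persistence \<open>\<nu>\<close> for shift 1. The minimum exists by \<open>persistence_exists\<close> below; this may
  fail for larger shifts.\<close>

definition persistence1 :: "nat \<Rightarrow> nat \<Rightarrow> nat" where
  "persistence1 b n = (LEAST k. periodic_point (sloane 1 b) ((sloane 1 b ^^ k) n))"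

lemma sloane_rec: "b \<ge> 2 \<Longrightarrow> n > 0 \<Longrightarrow> sloane t b n = (n mod b + t) * sloane t b (n div b)"
  by (simp add: sloane_def digits_rec)

lemma sloane1_le:
  assumes "b \<ge> 2" shows "sloane 1 b n \<le> n + 1"
  using assms
proof (induction n rule: digits_induct)
  case (step n)
  have "sloane 1 b n \<le> (n mod b + 1) * (n div b + 1)"
    using step assms by (simp only: sloane_rec mult_le_mono2)
  also have "\<dots> = (n mod b + 1) * (n div b) + n mod b + 1"
    by (simp add: algebra_simps)
  also have "\<dots> \<le> b * (n div b) + n mod b + 1"
    using assms by (intro add_right_mono mult_right_mono) (simp_all add: Suc_leI)
  also have "\<dots> = n + 1" by simp
  finally show ?case .
qed (simp add: sloane_def)

lemma sloane1_power:
  assumes "b \<ge> 2" shows "sloane 1 b (b ^ L) = 2"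
proof (induction L)
  case 0
  then show ?case using assms sloane_rec[of b 1 1] by (simp add: sloane_def)
next
  case (Suc L)
  then show ?case using assms sloane_rec[of b "b ^ Suc L" 1] by simp
qed

lemma persistence_exists:
  assumes b: "b \<ge> 2"
  shows "\<exists>k. periodic_point (sloane 1 b) ((sloane 1 b ^^ k) n)"
proof -
  let ?f = "sloane 1 b"
  define M where "M = b ^ Suc n"
  have "Suc n < 2 ^ Suc n" by (rule less_exp)
  also have "\<dots> \<le> M" unfolding M_def using b by (rule power_mono) simp
  finally have nM: "n \<le> M" by simp
  have M2: "2 \<le> M"
    using b self_le_power[of b "Suc n"] by (simp add: M_def del: power_Suc)
  have closed: "?f x \<le> M" if "x \<le> M" for x
  proof (cases "x = M")
    case True
    then show ?thesis using sloane1_power[OF b] M2 by (simp add: M_def del: power_Suc)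
  next
    case False
    then show ?thesis using sloane1_le[OF b, of x] that by linarith
  qed
  have "(?f ^^ k) n \<le> M" for k
    by (induction k) (use nM closed in auto)
  then have "finite (range (\<lambda>k. (?f ^^ k) n))"
    by (intro finite_subset[OF _ finite_atMost[of M]]) auto
  then have "\<not> inj (\<lambda>k. (?f ^^ k) n)"
    using finite_imageD infinite_UNIV_nat by blast
  then obtain i j where ij: "i < j" "(?f ^^ i) n = (?f ^^ j) n"
    by (metis (mono_tags, lifting) injI linorder_neqE_nat)
  have "(?f ^^ (j - i)) ((?f ^^ i) n) = (?f ^^ i) n"
    using ij by (metis add.commute comp_apply funpow_add le_add_diff_inverse less_imp_le)
  then show ?thesis
    unfolding periodic_point_def using ij(1) zero_less_diff by blast
qed

definition equidistributed :: "real \<Rightarrow> nat \<Rightarrow> nat \<Rightarrow> bool" where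
  "equidistributed \<epsilon> q n \<longleftrightarrow>
     (\<forall>d<q. \<bar>real (count_list (digits q n) d) / real (length (digits q n)) - 1 / real q\<bar> < \<epsilon>)"

definition conjecture_A :: bool where
  "conjecture_A \<longleftrightarrow>
     (\<forall>(q::nat) (F::nat set) (a::nat) (N::nat \<Rightarrow> nat).
        q > 1 \<longrightarrow> finite F \<longrightarrow> (\<forall>p\<in>F. prime p) \<longrightarrow> \<not> {p. prime p \<and> p dvd q} \<subseteq> F \<longrightarrow>
        a > 0 \<longrightarrow> N 0 = a \<longrightarrow> (\<forall>k. \<exists>p\<in>F. N (Suc k) = N k * p) \<longrightarrow>
        (\<forall>\<epsilon>>0. \<exists>n0. \<forall>n\<ge>n0. equidistributed \<epsilon> q (N n)))"

definition conjecture_B :: bool where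
  "conjecture_B \<longleftrightarrow>
     (\<forall>(q::nat) (F::nat set) (a::nat).
        q > 1 \<longrightarrow> finite F \<longrightarrow> (\<forall>p\<in>F. prime p) \<longrightarrow> \<not> {p. prime p \<and> p dvd q} \<subseteq> F \<longrightarrow>
        a > 0 \<longrightarrow>
        (\<forall>\<epsilon>>0. \<exists>N. \<forall>\<alpha>::nat \<Rightarrow> nat. (\<exists>p\<in>F. \<alpha> p \<ge> N) \<longrightarrow>
           equidistributed \<epsilon> q (a * (\<Prod>p\<in>F. p ^ \<alpha> p))))"

end

theory Submission
  imports Defs
begin

text \<open>
  Fix a prime \<open>q \<le> b\<close> not dividing \<open>b\<close>, and let \<open>S\<close> be the map \<open>sloane 1 b\<close>. Values of \<open>S\<close> are
  products of primes \<open>\<le> b\<close>. Stripping powers of \<open>b\<close> from such a number only removes zero digits, and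
  what remains is \<open>p\<^sup>e\<close> times a product of primes other than \<open>p\<close>, for some prime \<open>p\<close> dividing \<open>b\<close> and
  \<open>e\<close> smaller than the multiplicity of \<open>p\<close> in \<open>b\<close>. As there are finitely many pairs \<open>(p, e)\<close>, the
  conjecture applies uniformly: if the exponent of \<open>q\<close> in \<open>m\<close> is large, then \<open>m\<close> has many digits \<open>0\<close>
  and many digits \<open>q - 1\<close>. The latter make the exponent of \<open>q\<close> in \<open>S m\<close> large, so that the argument
  can be iterated any prescribed number of times. The former prevent \<open>m\<close> from being periodic: with
  three zero digits there is \<open>L\<close> with \<open>S m \<le> b\<^sup>L < m\<close>, and \<open>{..b\<^sup>L}\<close> is mapped into itself by \<open>S\<close>.
  For \<open>b = 3, 4\<close> only one prime remains besides \<open>p\<close>, and Conjecture A suffices.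
\<close>

section \<open>Digit counts, lengths and the effect of zero digits\<close>

lemma digits_mult_base:
  assumes "b \<ge> 2" "m > 0"
  shows "digits b (b * m) = 0 # digits b m"
  using assms by (subst digits_rec) auto

lemma count_digits_power_mult_ge:
  assumes "b \<ge> 2" "m > 0"
  shows "count_list (digits b (b ^ v * m)) d \<ge> count_list (digits b m) d"
proof (induction v)
  case (Suc v)
  have "digits b (b ^ Suc v * m) = 0 # digits b (b ^ v * m)"
    using digits_mult_base[of b "b ^ v * m"] assms by (simp add: mult.assoc)
  then show ?case using Suc by (auto intro: le_SucI)
qed simp

text \<open>With \<open>l\<close> the number of digits, the second bound is
  \<open>b^(l-1) <= n\<close> written without truncated subtraction.\<close>

lemma power_length_digits:
  assumes "b \<ge> 2"
  shows "n < b ^ length (digits b n)" and "n > 0 \<Longrightarrow> b ^ length (digits b n) \<le> b * n"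
proof -
  have "n < b ^ length (digits b n) \<and> (n > 0 \<longrightarrow> b ^ length (digits b n) \<le> b * n)"
    using assms
  proof (induction n rule: digits_induct)
    case (step n)
    let ?l = "length (digits b (n div b))"
    have eq: "length (digits b n) = Suc ?l"
      using step assms by (simp add: digits_rec)
    have "n div b < b ^ ?l" using step by simp
    then have "n < b ^ ?l * b"
      by (metis assms div_less_iff_less_mult pos2 order_less_le_trans)
    moreover have "b ^ ?l \<le> n"
    proof (cases "n div b = 0")
      case False
      then have "b ^ ?l \<le> b * (n div b)" using step by simp
      also have "\<dots> \<le> n" by simp
      finally show ?thesis .
    qed (use step in simp)
    ultimately show ?case using eq by (simp add: mult.commute)
  qed simp
  then show "n < b ^ length (digits b n)" and "n > 0 \<Longrightarrow> b ^ length (digits b n) \<le> b * n"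
    by auto
qed

text \<open>Every digit contributes a factor at most \<open>b\<close>; a zero digit contributes only
  1 and so leaves a whole factor \<open>b\<close> to spare.\<close>

lemma sloane1_zeros_bound:
  assumes "b \<ge> 2"
  shows "sloane 1 b n * b ^ count_list (digits b n) 0 \<le> b ^ length (digits b n)"
  using assms
proof (induction n rule: digits_induct)
  case (step n)
  let ?k = "count_list (digits b (n div b)) 0" and ?l = "length (digits b (n div b))"
  have eq: "digits b n = n mod b # digits b (n div b)"
    using step assms by (simp add: digits_rec)
  have rec: "sloane 1 b n = (n mod b + 1) * sloane 1 b (n div b)"
    using step assms by (simp only: sloane_rec)
  show ?case
  proof (cases "n mod b = 0")
    case True
    then show ?thesis using eq rec step.IH by simp
  next
    case False
    have "n mod b < b" using assms by simp
    then have "(n mod b + 1) * (sloane 1 b (n div b) * b ^ ?k) \<le> b * b ^ ?l"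
      using step.IH by (intro mult_le_mono) auto
    then show ?thesis unfolding eq rec using False by (simp add: mult.assoc del: mult_Suc)
  qed
qed (simp add: sloane_def)

text \<open>The map raises a value by at most 1, so only \<open>b ^ L\<close> itself could escape,
  and that is sent to 2. Positivity of \<open>L\<close> ensures \<open>2 <= b ^ L\<close>.\<close>

lemma sloane1_le_power:
  assumes "b \<ge> 2" "L > 0" "x \<le> b ^ L"
  shows "sloane 1 b x \<le> b ^ L"
proof (cases "x = b ^ L")
  case True
  then show ?thesis
    using sloane1_power[OF assms(1), of L] self_le_power[of b L] assms by simp
next
  case False
  then show ?thesis using sloane1_le[OF assms(1), of x] assms by linarith
qed

lemma three_zeros_imp_not_periodic:
  assumes b: "b \<ge> 2" and zeros: "count_list (digits b n) 0 \<ge> 3"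
  shows "\<not> periodic_point (sloane 1 b) n"
proof
  assume "periodic_point (sloane 1 b) n"
  then obtain m where m: "m > 0" "(sloane 1 b ^^ m) n = n"
    unfolding periodic_point_def by blast
  let ?l = "length (digits b n)"
  \<comment> \<open>Two of the zeros bring the image down to at most \<open>b ^ L\<close>, while the
    leading digit keeps \<open>n\<close> at \<open>b ^ (L + 1)\<close> or more. The count of three
    forces \<open>?l >= 3\<close>, hence \<open>L > 0\<close>.\<close>
  define L where "L = ?l - 2"
  have l: "?l = Suc (Suc L)" and L: "L > 0"
    using zeros count_le_length[of "digits b n" 0] by (auto simp: L_def)
  have n: "n > 0" using zeros by (cases "n = 0") auto
  have "b * b ^ L \<le> n" using power_length_digits(2)[OF b n] b l by simp
  moreover have "b * b ^ L > b ^ L" using b by simp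
  ultimately have less: "b ^ L < n" by linarith
  have "sloane 1 b n * b ^ 2 \<le> sloane 1 b n * b ^ count_list (digits b n) 0"
    using b zeros by (intro mult_le_mono2 power_increasing) auto
  also have "\<dots> \<le> b ^ L * b ^ 2"
    using sloane1_zeros_bound[OF b, of n] l by (simp add: power2_eq_square mult_ac)
  finally have start: "sloane 1 b n \<le> b ^ L" using b by simp
  have "(sloane 1 b ^^ Suc k) n \<le> b ^ L" for k
    by (induction k) (use start sloane1_le_power[OF b L] in auto)
  from this[of "m - 1"] show False using m less by simp
qed

section \<open>Prime factors of the values\<close>

lemma sloane1_pos: "sloane 1 b n > 0"
proof -
  have "0 < (\<Prod>d\<leftarrow>xs. d + 1)" for xs :: "nat list"
    by (induction xs) auto
  then show ?thesis by (simp add: sloane_def)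
qed

lemma prime_dvd_sloane1_le:
  assumes "b \<ge> 2" "prime r" "r dvd sloane 1 b n"
  shows "r \<le> b"
  using assms(1,3)
proof (induction n rule: digits_induct)
  case zero
  then show ?case using assms(2) by (simp add: sloane_def)
next
  case (step n)
  then have "r dvd (n mod b + 1) * sloane 1 b (n div b)"
    using assms(1) by (simp only: sloane_rec)
  then consider "r dvd n mod b + 1" | "r dvd sloane 1 b (n div b)"
    using assms(2) prime_dvd_mult_iff by blast
  then show ?case
  proof cases
    case 1
    then have "r \<le> n mod b + 1" by (intro dvd_imp_le) auto
    moreover have "n mod b < b" using assms(1) by simp
    ultimately show ?thesis by linarith
  qed (use step in auto)
qed

text \<open>Each digit \<open>q - 1\<close> contributes a factor \<open>q\<close>. This is how digit
  counts turn into exponents for the next iterate.\<close>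

lemma power_count_dvd_sloane1:
  assumes "q > 0"
  shows "q ^ count_list (digits b n) (q - 1) dvd sloane 1 b n"
proof -
  have "q ^ count_list xs (q - 1) dvd (\<Prod>d\<leftarrow>xs. d + 1)" for xs :: "nat list"
  proof (induction xs)
    case (Cons d xs)
    show ?case
    proof (cases "d = q - 1")
      case True
      then have "d + 1 = q" using assms by simp
      then show ?thesis using Cons True by (simp add: mult_dvd_mono del: mult_Suc)
    qed (use Cons in \<open>simp add: dvd_mult\<close>)
  qed simp
  then show ?thesis by (simp add: sloane_def)
qed

section \<open>From equidistribution to absolute digit counts\<close>

lemma equidistributed_count_ge:
  assumes b: "b \<ge> 2" and m: "m > 0" and d: "d < b"
    and eq: "equidistributed (1 / (2 * real b)) b m"
    and large: "2 ^ (2 * b ^ 2 * X) \<le> m"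
  shows "count_list (digits b m) d \<ge> X"
proof -
  let ?l = "length (digits b m)" and ?c = "count_list (digits b m) d"
  \<comment> \<open>This crude bound replaces logarithms: \<open>m < b ^ ?l <= 2 ^ (b * ?l)\<close>,
    so comparing exponents of 2 gives \<open>2 * b * X < ?l\<close>. Each digit has frequency above
    \<open>1/b - 1/(2b) = 1/(2b)\<close>, which yields more than \<open>X\<close>
    occurrences.\<close>
  have "b \<le> 2 ^ b" by (simp add: less_imp_le)
  then have "b ^ ?l \<le> 2 ^ (b * ?l)" by (simp add: power_mult power_mono)
  then have "(2::nat) ^ (2 * b ^ 2 * X) < 2 ^ (b * ?l)"
    using large power_length_digits(1)[OF b, of m] by linarith
  then have "2 * b ^ 2 * X < b * ?l" by simp
  then have "b * (2 * b * X) < b * ?l" by (simp add: power2_eq_square mult_ac)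
  then have l: "2 * b * X < ?l" using b by simp
  then have l0: "real ?l > 0" by linarith
  have "\<bar>real ?c / real ?l - 1 / real b\<bar> < 1 / (2 * real b)"
    using eq d by (simp add: equidistributed_def)
  then have "1 / (2 * real b) < real ?c / real ?l"
    by (simp add: abs_less_iff field_simps)
  then have "real ?l < 2 * real b * real ?c"
    using l0 b by (simp add: field_simps)
  then have "?l < 2 * b * ?c"
    by (metis (mono_tags, lifting) of_nat_less_iff of_nat_mult of_nat_numeral)
  with l have "2 * b * X < 2 * b * ?c" by linarith
  then show ?thesis by simp
qed

text \<open>The conclusion of Conjecture B for one fixed pair \<open>q\<close>, \<open>F\<close>: a
  common interface that Conjecture A supplies for singletons.\<close>

definition products_equidistributed :: "nat \<Rightarrow> nat set \<Rightarrow> bool" where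
  "products_equidistributed q F \<longleftrightarrow>
     (\<forall>a>0. \<forall>\<epsilon>>0. \<exists>N. \<forall>\<alpha>::nat \<Rightarrow> nat. (\<exists>p\<in>F. \<alpha> p \<ge> N) \<longrightarrow>
        equidistributed \<epsilon> q (a * (\<Prod>p\<in>F. p ^ \<alpha> p)))"

text \<open>With a single prime the only admissible sequence is \<open>a * r ^ n\<close>, so its
  index is the exponent of \<open>r\<close>.\<close>

lemma conjecture_A_imp_singleton:
  assumes "conjecture_A" "q > 1" "prime r" "\<not> {p. prime p \<and> p dvd q} \<subseteq> {r}"
  shows "products_equidistributed q {r}"
  unfolding products_equidistributed_def
proof (intro allI impI)
  fix a :: nat and \<epsilon> :: real assume "a > 0" "\<epsilon> > 0"
  then have "\<exists>n0. \<forall>n\<ge>n0. equidistributed \<epsilon> q (a * r ^ n)"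
    using assms(1)[unfolded conjecture_A_def, rule_format,
        of q "{r}" a "\<lambda>n. a * r ^ n" \<epsilon>] assms(2-4)
    by simp
  then show "\<exists>N. \<forall>\<alpha>. (\<exists>p\<in>{r}. N \<le> \<alpha> p) \<longrightarrow>
      equidistributed \<epsilon> q (a * (\<Prod>p\<in>{r}. p ^ \<alpha> p))"
    by auto
qed

lemma conjecture_B_imp_products:
  assumes "conjecture_B" "q > 1" "finite F" "\<And>p. p \<in> F \<Longrightarrow> prime p"
    "\<not> {p. prime p \<and> p dvd q} \<subseteq> F"
  shows "products_equidistributed q F"
  using assms unfolding conjecture_B_def products_equidistributed_def by blast

section \<open>Smooth numbers and iteration of the map\<close>

locale equidistributed_base =
  fixes b q :: nat
  assumes b: "b \<ge> 2" and q: "prime q" "q \<le> b" "\<not> q dvd b"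
    and products: "\<And>p. prime p \<Longrightarrow> p dvd b \<Longrightarrow>
      products_equidistributed b {r. prime r \<and> r \<le> b \<and> r \<noteq> p}"
begin

definition smooth :: "nat \<Rightarrow> bool" where
  "smooth m \<longleftrightarrow> m > 0 \<and> (\<forall>r. prime r \<longrightarrow> r dvd m \<longrightarrow> r \<le> b)"

lemma smooth_sloane1: "smooth (sloane 1 b n)"
  using sloane1_pos prime_dvd_sloane1_le[OF b] by (simp add: smooth_def)

lemma smooth_decomposition:
  assumes m: "smooth m" and p: "prime p" "p \<le> b"
  shows "m = p ^ multiplicity p m *
    (\<Prod>r\<in>{r. prime r \<and> r \<le> b \<and> r \<noteq> p}. r ^ multiplicity r m)"
proof -
  let ?P = "{r. prime r \<and> r \<le> b}"
  have fin: "finite ?P" by simp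
  have "m = (\<Prod>r\<in>prime_factors m. r ^ multiplicity r m)"
    using m by (simp add: smooth_def prime_factorization_nat)
  also have "\<dots> = (\<Prod>r\<in>?P. r ^ multiplicity r m)"
    using m fin
    by (intro prod.mono_neutral_left)
      (auto simp: smooth_def in_prime_factors_iff not_dvd_imp_multiplicity_0)
  also have "\<dots> = p ^ multiplicity p m * (\<Prod>r\<in>?P - {p}. r ^ multiplicity r m)"
    using p fin by (intro prod.remove) auto
  also have "?P - {p} = {r. prime r \<and> r \<le> b \<and> r \<noteq> p}" by auto
  finally show ?thesis .
qed

lemma not_dvd_imp_equidistributed:
  assumes "\<epsilon> > 0"
  shows "\<exists>N. \<forall>m. smooth m \<longrightarrow> \<not> b dvd m \<longrightarrow> multiplicity q m \<ge> N \<longrightarrow> equidistributed \<epsilon> b m"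
proof -
  let ?F = "\<lambda>p. {r. prime r \<and> r \<le> b \<and> r \<noteq> p}"
  let ?P = "{p. prime p \<and> p dvd b}"
  \<comment> \<open>The power \<open>p ^ e\<close> plays the role of the constant factor
    \<open>a\<close> of the conjecture.\<close>
  define Q where "Q p e N \<longleftrightarrow> (\<forall>\<alpha>. (\<exists>r\<in>?F p. \<alpha> r \<ge> N) \<longrightarrow>
      equidistributed \<epsilon> b (p ^ e * (\<Prod>r\<in>?F p. r ^ \<alpha> r)))" for p e N
  have "\<exists>N. Q p e N" if "p \<in> ?P" for p e
  proof -
    have "p ^ e > 0" using that by (simp add: prime_gt_0_nat)
    then show ?thesis
      using products[of p] that assms unfolding products_equidistributed_def Q_def by blast
  qed
  then obtain N where N: "\<And>p e. p \<in> ?P \<Longrightarrow> Q p e (N p e)"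
    by metis
  define I where "I = Sigma ?P (\<lambda>p. {..<multiplicity p b})"
  have "finite ?P" using b by (intro finite_subset[OF _ finite_atMost[of b]]) (auto dest: dvd_imp_le)
  then have fin: "finite I" by (simp add: I_def)
  show ?thesis
  proof (intro exI allI impI)
    fix m
    \<comment> \<open>The sum over the finite set \<open>I\<close> dominates every single threshold
      \<open>N p e\<close>.\<close>
    assume m: "smooth m" "\<not> b dvd m" and large: "multiplicity q m \<ge> (\<Sum>(p, e)\<in>I. N p e)"
    have "b \<noteq> 0" using b by simp
    then obtain p where p: "prime p" "multiplicity p m < multiplicity p b"
      using m(2) multiplicity_le_imp_dvd[of b m] not_le by blast
    have pb: "p dvd b" using p(2) not_dvd_imp_multiplicity_0 by force
    have "(p, multiplicity p m) \<in> I" using p pb by (simp add: I_def)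
    then have "N p (multiplicity p m) \<le> (\<Sum>(p, e)\<in>I. N p e)"
      using member_le_sum[of "(p, multiplicity p m)" I "\<lambda>(p, e). N p e"] fin by simp
    then have "N p (multiplicity p m) \<le> multiplicity q m" using large by simp
    moreover have "q \<in> ?F p" using q pb by auto
    moreover have "Q p (multiplicity p m) (N p (multiplicity p m))" using N p pb by simp
    ultimately have "equidistributed \<epsilon> b
        (p ^ multiplicity p m * (\<Prod>r\<in>?F p. r ^ multiplicity r m))"
      unfolding Q_def by (elim allE[where x = "\<lambda>r. multiplicity r m"] impE) (rule bexI)
    moreover have "p \<le> b" using pb b by (auto dest: dvd_imp_le)
    ultimately show "equidistributed \<epsilon> b m"
      using smooth_decomposition[OF m(1) p(1)] by simp
  qed
qed

text \<open>Powers of \<open>b\<close> in \<open>m\<close> append zeros and can spoil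
  equidistribution, but they never lower an absolute count. Since \<open>q\<close> does not divide
  \<open>b\<close>, stripping them leaves the exponent of \<open>q\<close> unchanged.\<close>

lemma smooth_count_digits_ge:
  "\<exists>N. \<forall>m. smooth m \<longrightarrow> multiplicity q m \<ge> N \<longrightarrow> (\<forall>d<b. count_list (digits b m) d \<ge> X)"
proof -
  obtain N where N: "\<And>m. smooth m \<Longrightarrow> \<not> b dvd m \<Longrightarrow> multiplicity q m \<ge> N \<Longrightarrow>
      equidistributed (1 / (2 * real b)) b m"
    using not_dvd_imp_equidistributed[of "1 / (2 * real b)"] b by auto
  show ?thesis
  proof (intro exI allI impI)
    fix m d
    \<comment> \<open>The summand \<open>N\<close> secures equidistribution of the stripped number;
      \<open>2 * b ^ 2 * X\<close> makes it large enough to have the digits required.\<close>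
    assume m: "smooth m" and large: "multiplicity q m \<ge> N + 2 * b ^ 2 * X" and d: "d < b"
    have m0: "m \<noteq> 0" using m by (simp add: smooth_def)
    obtain m' where m': "m = b ^ multiplicity b m * m'" "\<not> b dvd m'"
      using multiplicity_decompose'[of m b] m0 b by auto
    have m'0: "m' > 0" using m' m0 by (cases "m' = 0") auto
    have "smooth m'" using m m' m'0 unfolding smooth_def by (metis dvd_mult)
    have "multiplicity q (b ^ multiplicity b m) = 0"
      using q prime_dvd_power not_dvd_imp_multiplicity_0 by metis
    then have "multiplicity q m = multiplicity q m'"
      using prime_elem_multiplicity_mult_distrib[of q "b ^ multiplicity b m" m'] m'(1) q m'0 b
      by simp
    with large have large': "multiplicity q m' \<ge> N + 2 * b ^ 2 * X" by simp
    have "2 ^ (2 * b ^ 2 * X) \<le> q ^ (2 * b ^ 2 * X)"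
      using q by (intro power_mono prime_ge_2_nat) auto
    also have "\<dots> \<le> m'"
      using large' m'0 by (intro dvd_imp_le[OF multiplicity_dvd']) auto
    finally have "count_list (digits b m') d \<ge> X"
      using N[OF \<open>smooth m'\<close> m'(2)] large' equidistributed_count_ge[OF b m'0 d] by simp
    also have "count_list (digits b m') d \<le> count_list (digits b m) d"
      by (subst m'(1)) (rule count_digits_power_mult_ge[OF b m'0])
    finally show "count_list (digits b m) d \<ge> X" .
  qed
qed

text \<open>Induction on \<open>t\<close> with a threshold uniform in \<open>m\<close>, since the
  hypothesis is applied to \<open>sloane 1 b m\<close>.\<close>

lemma iterates_three_zeros:
  "\<exists>N. \<forall>m. smooth m \<longrightarrow> multiplicity q m \<ge> N \<longrightarrow>
     (\<forall>k<t. count_list (digits b ((sloane 1 b ^^ k) m)) 0 \<ge> 3)"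
proof (induction t)
  case (Suc t)
  then obtain N where N: "\<And>m k. smooth m \<Longrightarrow> multiplicity q m \<ge> N \<Longrightarrow> k < t \<Longrightarrow>
      count_list (digits b ((sloane 1 b ^^ k) m)) 0 \<ge> 3"
    by blast
  \<comment> \<open>The 3 serves the zeros of \<open>m\<close> itself; the \<open>N\<close> serves
    the digits \<open>q - 1\<close>, which put \<open>q ^ N\<close> into the next iterate.\<close>
  obtain M where M: "\<And>m d. smooth m \<Longrightarrow> multiplicity q m \<ge> M \<Longrightarrow> d < b \<Longrightarrow>
      count_list (digits b m) d \<ge> N + 3"
    using smooth_count_digits_ge[of "N + 3"] by blast
  show ?case
  proof (intro exI allI impI)
    fix m k assume m: "smooth m" "multiplicity q m \<ge> M" and k: "k < Suc t"
    show "count_list (digits b ((sloane 1 b ^^ k) m)) 0 \<ge> 3"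
    proof (cases k)
      case 0
      then show ?thesis using M[OF m, of 0] b by simp
    next
      case (Suc j)
      have q0: "q > 0" using q by (simp add: prime_gt_0_nat)
      have "q - 1 < b" using q q0 by linarith
      then have "N \<le> count_list (digits b m) (q - 1)" using M[OF m] by fastforce
      also have "\<dots> \<le> multiplicity q (sloane 1 b m)"
        using power_count_dvd_sloane1[OF q0] sloane1_pos[of b m] q
        by (intro multiplicity_geI) auto
      finally show ?thesis
        using N[OF smooth_sloane1, of m j] Suc k by (simp add: funpow_swap1)
    qed
  qed
qed simp

lemma persistence1_unbounded: "\<exists>n>0. persistence1 b n \<ge> t"
proof -
  obtain N where N: "\<And>m k. smooth m \<Longrightarrow> multiplicity q m \<ge> N \<Longrightarrow> k < t \<Longrightarrow>
      count_list (digits b ((sloane 1 b ^^ k) m)) 0 \<ge> 3"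
    using iterates_three_zeros[of t] by blast
  \<comment> \<open>The starting value is \<open>q ^ N\<close>: it is smooth because
    \<open>q <= b\<close>, and its exponent of \<open>q\<close> meets the threshold exactly.\<close>
  have pos: "q ^ N > 0" using q by (simp add: prime_gt_0_nat)
  have "smooth (q ^ N)"
    using q pos prime_dvd_power primes_dvd_imp_eq unfolding smooth_def by blast
  moreover have "multiplicity q (q ^ N) = N"
    using q prime_gt_1_nat[of q] by (simp add: multiplicity_same_power)
  ultimately have nonper: "\<not> periodic_point (sloane 1 b) ((sloane 1 b ^^ k) (q ^ N))"
    if "k < t" for k
    using N that three_zeros_imp_not_periodic[OF b] by simp
  have "periodic_point (sloane 1 b) ((sloane 1 b ^^ persistence1 b (q ^ N)) (q ^ N))"
    unfolding persistence1_def using persistence_exists[OF b] by (rule LeastI_ex)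
  then have "persistence1 b (q ^ N) \<ge> t" using nonper not_le by blast
  then show ?thesis using pos by blast
qed

end

section \<open>Choice of the auxiliary prime for each base\<close>

theorem theorem10:
  shows "(conjecture_A \<longrightarrow>
            (\<forall>b\<in>{3, 4}. \<forall>t::nat. t > 0 \<longrightarrow> (\<exists>n>0. persistence1 b n \<ge> t))) \<and>
         (conjecture_B \<longrightarrow>
            (\<forall>b\<ge>5. \<forall>t::nat. t > 0 \<longrightarrow> (\<exists>n>0. persistence1 b n \<ge> t)))"
proof (intro conjI impI ballI allI)
  fix b t :: nat assume A: "conjecture_A" and "b \<in> {3, 4}"
  then consider "b = 3" | "b = 4" by blast
  then show "\<exists>n>0. persistence1 b n \<ge> t"
  proof cases
    case 1
    have "products_equidistributed 3 {r. prime r \<and> r \<le> 3 \<and> r \<noteq> p}"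
      if p: "prime p" "p dvd 3" for p :: nat
    proof -
      have p3: "p = 3" using p by (intro primes_dvd_imp_eq) auto
      have "r = 2" if "prime r" "r \<le> 3" "r \<noteq> 3" for r :: nat
        using that prime_ge_2_nat[of r] by linarith
      then have "{r. prime r \<and> r \<le> 3 \<and> r \<noteq> p} = {2}" using p3 by auto
      moreover have "p \<in> {p. prime p \<and> p dvd 3}" "p \<notin> {2}" using p p3 by simp_all
      then have "\<not> {p. prime p \<and> p dvd 3} \<subseteq> {2::nat}" by blast
      ultimately show ?thesis using conjecture_A_imp_singleton[OF A, of 3 2] by simp
    qed
    then interpret equidistributed_base 3 2 by unfold_locales auto
    show ?thesis using persistence1_unbounded 1 by simp
  next
    case 2
    have "products_equidistributed 4 {r. prime r \<and> r \<le> 4 \<and> r \<noteq> p}"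
      if p: "prime p" "p dvd 4" for p :: nat
    proof -
      have "p dvd 2 ^ 2" using p by simp
      then have p2: "p = 2" using p prime_dvd_power primes_dvd_imp_eq two_is_prime_nat by blast
      have "\<not> prime (4::nat)" by simp
      then have "r = 3" if "prime r" "r \<le> 4" "r \<noteq> 2" for r :: nat
        using that prime_ge_2_nat[of r] by (cases "r = 4") auto
      then have "{r. prime r \<and> r \<le> 4 \<and> r \<noteq> p} = {3}" using p2 by auto
      moreover have "p \<in> {p. prime p \<and> p dvd 4}" "p \<notin> {3}" using p p2 by simp_all
      then have "\<not> {p. prime p \<and> p dvd 4} \<subseteq> {3::nat}" by blast
      ultimately show ?thesis using conjecture_A_imp_singleton[OF A, of 4 3] by simp
    qed
    then interpret equidistributed_base 4 3 by unfold_locales auto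
    show ?thesis using persistence1_unbounded 2 by simp
  qed
next
  fix b t :: nat assume B: "conjecture_B" and b: "b \<ge> 5"
  \<comment> \<open>Consecutive integers are coprime, so a prime factor of \<open>b - 1\<close> does
    not divide \<open>b\<close>.\<close>
  obtain q where q: "prime q" "q dvd b - 1"
    using prime_factor_nat[of "b - 1"] b by force
  have "q \<le> b - 1" using q b by (intro dvd_imp_le) auto
  moreover have "\<not> q dvd b"
  proof
    assume "q dvd b"
    then have "q dvd b - (b - 1)" using q(2) by (rule dvd_diff_nat)
    then show False using q b by simp
  qed
  \<comment> \<open>The set omits \<open>p\<close>, a prime divisor of \<open>b\<close>, as the
    hypothesis of the conjecture demands.\<close>
  moreover have "products_equidistributed b {r. prime r \<and> r \<le> b \<and> r \<noteq> p}"
    if "prime p" "p dvd b" for p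
    using that b by (intro conjecture_B_imp_products[OF B]) auto
  ultimately interpret equidistributed_base b q
    using q b by unfold_locales auto
  show "\<exists>n>0. persistence1 b n \<ge> t" by (rule persistence1_unbounded)
qed

end
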